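(* For any integer pair $(c,d)$ with $0<d<c$ and $\gcd(c,d)=1$, there exist infinitely many positive integer pairs $(x,y)$ such that there exists an $(a,b)$-regular bipartite graph $G$ of order $(n,m)$, where $n=xc$, $m=yc$, $a=yd$, $b=xd$, with $b=n-m+1$. All such pairs $(x_l,y_l)$ are coprime and can be computed as $(x_l,y_l)=(x_l,x_l-z_l)$, with $(x_l,z_l)=(x_0+lc,\;z_0+ld)$ for any positive integer $l$, where $x_0$ and $(-z_0)$ are Bézout coefficients for $d$ and $c$ in $dx+c(-z)=1$.
   Context: All graphs are finite, simple and undirected. A bipartite graph $G=(U,V;E)$ has color classes $U,V$; it is of order $(n,m)$ if $|U|=n$ and $|V|=m$, and it is $(a,b)$-regular if every vertex of $U$ has degree $a$ and every vertex of $V$ has degree $b$. It is assumed throughout that $n>m>1$. Given a linear Diophantine equation $\alpha\phi+\beta\psi=\gamma$, integers $\phi$ and $\psi$ satisfying it are called Bézout coefficients for $\alpha$ and $\beta$; thus $x_0$ and $-z_0$ are integers with $dx_0+c(-z_0)=1$.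
   Formalization: For arbitrary Bézout coefficients "any positive l" fails (c=3, d=2, x_0=-4, z_0=-3, l=1 gives x=-1); proved: some coefficients give exactly all pairs for l>0; any coefficients give them as the integers l with x_l>y_l>0; for x_0,z_0≥0 every l>0 works. *)

theory Defs
  imports "Graph_Theory.Pair_Digraph"
begin

(* As in the Graph_Theory library, a finite simple undirected graph is a finite loop-free
   symmetric digraph without parallel arcs (pair_graph): an edge uv is the pair of arcs
   (u,v), (v,u), so the degree of a vertex is its out-degree. *)

definition bipartite_graph :: "'a set \<Rightarrow> 'a set \<Rightarrow> 'a pair_pre_digraph \<Rightarrow> bool" where
  "bipartite_graph U V G \<longleftrightarrow>
     pair_graph G \<and> pverts G = U \<union> V \<and> U \<inter> V = {} \<and> parcs G \<subseteq> U \<times> V \<union> V \<times> U"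

definition has_order :: "'a set \<Rightarrow> 'a set \<Rightarrow> nat \<Rightarrow> nat \<Rightarrow> bool" where
  "has_order U V n m \<longleftrightarrow> card U = n \<and> card V = m"

definition biregular :: "nat \<Rightarrow> nat \<Rightarrow> 'a set \<Rightarrow> 'a set \<Rightarrow> 'a pair_pre_digraph \<Rightarrow> bool" where
  "biregular a b U V G \<longleftrightarrow>
     (\<forall>u\<in>U. out_degree (with_proj G) u = a) \<and> (\<forall>v\<in>V. out_degree (with_proj G) v = b)"

(* Every finite graph is isomorphic to one whose vertices are natural numbers, so choosing
   nat as vertex type loses nothing. The condition 1 < m < n is the standing assumption
   on the order of a bipartite graph. *)

definition admissible_pairs :: "int \<Rightarrow> int \<Rightarrow> (int \<times> int) set" where
  "admissible_pairs c d = {(x, y). 0 < x \<and> 0 < y \<and>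
     (\<exists>n m a b :: nat.
        int n = x * c \<and> int m = y * c \<and> int a = y * d \<and> int b = x * d \<and>
        1 < m \<and> m < n \<and>
        int b = int n - int m + 1 \<and>
        (\<exists>(U :: nat set) V G.
           bipartite_graph U V G \<and> has_order U V n m \<and> biregular a b U V G))}"

definition bezout_pair :: "int \<Rightarrow> int \<Rightarrow> int \<Rightarrow> int \<Rightarrow> int \<Rightarrow> int \<times> int" where
  "bezout_pair c d x0 z0 l = (let x = x0 + l * c; z = z0 + l * d in (x, x - z))"

end

theory Submission
  imports Defs
begin

text \<open>
  With \<open>z = x - y\<close>, the condition \<open>b = n - m + 1\<close> is the Diophantine equation \<open>d x - c z = 1\<close>, and
  \<open>n > m\<close> is \<open>z > 0\<close>; positivity of \<open>x\<close> and \<open>y\<close> is then automatic. Every solution is realised by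
  a graph: split \<open>U\<close> and \<open>V\<close> into residue classes modulo \<open>c\<close>, of sizes \<open>x\<close> and \<open>y\<close>, and join
  \<open>u\<close> to \<open>v\<close> when \<open>(v - u) mod c < d\<close>.
\<close>

section \<open>Counting integers with small residue in intervals\<close>

text \<open>A window of \<open>c\<close> consecutive integers meets every residue class modulo
  \<open>c\<close> exactly once, so each of the residues below \<open>d\<close> contributes one
  element.\<close>

lemma card_mod_less_period:
  fixes c d s :: int
  assumes "0 < c" "d \<le> c"
  shows "card {v \<in> {s..<s + c}. v mod c < d} = nat d"
proof -
  have "bij_betw (\<lambda>v. v mod c) {v \<in> {s..<s + c}. v mod c < d} {0..<d}"
  \<comment> \<open>The inverse map picks the unique representative of the residue \<open>r\<close>
    in the window that starts at \<open>s\<close>.\<close>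
  proof (rule bij_betw_byWitness[where f' = "\<lambda>r. s + (r - s) mod c"])
    show "\<forall>v\<in>{v \<in> {s..<s + c}. v mod c < d}. s + (v mod c - s) mod c = v"
      using assms by (auto simp: mod_simps)
    show "\<forall>r\<in>{0..<d}. (s + (r - s) mod c) mod c = r"
      using assms by (auto simp: mod_simps)
    show "(\<lambda>v. v mod c) ` {v \<in> {s..<s + c}. v mod c < d} \<subseteq> {0..<d}"
      using assms by auto
    show "(\<lambda>r. s + (r - s) mod c) ` {0..<d} \<subseteq> {v \<in> {s..<s + c}. v mod c < d}"
      using assms by (auto simp: mod_simps)
  qed
  then show ?thesis
    using bij_betw_same_card by fastforce
qed

text \<open>The window is cut into \<open>k\<close> full periods. The start \<open>s\<close> is
  arbitrary because the windows that give the vertex degrees shift with the vertex.\<close>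

lemma card_mod_less:
  fixes c d s :: int
  assumes "0 < c" "d \<le> c"
  shows "card {v \<in> {s..<s + int k * c}. v mod c < d} = k * nat d"
proof (induction k)
  case (Suc k)
  let ?A = "{v \<in> {s..<s + int k * c}. v mod c < d}"
  let ?B = "{v \<in> {s + int k * c..<s + int k * c + c}. v mod c < d}"
  have "{s..<s + int k * c} \<union> {s + int k * c..<s + int k * c + c} = {s..<s + int k * c + c}"
    using assms by (intro ivl_disj_un_two) auto
  then have "{v \<in> {s..<s + int (Suc k) * c}. v mod c < d} = ?A \<union> ?B"
    by (auto simp: distrib_right add_ac)
  moreover have "card (?A \<union> ?B) = card ?A + card ?B"
  proof (rule card_Un_disjoint)
    show "finite ?A" "finite ?B"
      by (simp_all del: atLeastLessThan_iff)
    show "?A \<inter> ?B = {}"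
      by auto
  qed
  ultimately show ?case
    using Suc card_mod_less_period[OF assms, of "s + int k * c"] by simp
qed simp

section \<open>Construction of the biregular graphs\<close>

lemma bipartite_graph_of_relation:
  assumes "finite U" "finite V" "U \<inter> V = {}" "R \<subseteq> U \<times> V"
  shows "bipartite_graph U V \<lparr>pverts = U \<union> V, parcs = R \<union> R\<inverse>\<rparr>"
proof -
  have "finite R"
    using assms finite_subset by blast
  then have "pair_graph \<lparr>pverts = U \<union> V, parcs = R \<union> R\<inverse>\<rparr>"
    using assms by unfold_locales (auto simp: sym_Un_converse symmetric_def)
  then show ?thesis
    using assms unfolding bipartite_graph_def by auto
qed

lemma out_degree_with_proj: "out_degree (with_proj G) u = card (parcs G `` {u})"
proof -
  have "out_arcs (with_proj G) u = Pair u ` (parcs G `` {u})"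
    by (auto simp: out_arcs_def)
  then show ?thesis
    by (simp add: out_degree_def card_image inj_on_def)
qed

text \<open>By disjointness, arcs of \<open>R\<close> start only in \<open>U\<close> and arcs of the
  converse only in \<open>V\<close>, so each degree can be read off from one of the two
  relations.\<close>

lemma biregular_of_relation:
  assumes "U \<inter> V = {}" "R \<subseteq> U \<times> V"
    and "\<And>u. u \<in> U \<Longrightarrow> card (R `` {u}) = a" "\<And>v. v \<in> V \<Longrightarrow> card (R\<inverse> `` {v}) = b"
  shows "biregular a b U V \<lparr>pverts = U \<union> V, parcs = R \<union> R\<inverse>\<rparr>"
proof -
  have "(R \<union> R\<inverse>) `` {u} = R `` {u}" if "u \<in> U" for u
    using that assms by auto
  moreover have "(R \<union> R\<inverse>) `` {v} = R\<inverse> `` {v}" if "v \<in> V" for v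
    using that assms by auto
  ultimately show ?thesis
    using assms unfolding biregular_def by (simp add: out_degree_with_proj)
qed

lemma biregular_bipartite_graph_exists:
  fixes c d x y :: nat
  assumes "0 < c" "d \<le> c"
  shows "\<exists>(U :: nat set) V G. bipartite_graph U V G \<and> has_order U V (x * c) (y * c)
           \<and> biregular (y * d) (x * d) U V G"
proof -
  define N M where "N = x * c" and "M = y * c"
  define U where "U = {0..<N}"
  define V where "V = {N..<N + M}"
  define R where "R = {(u, v). u \<in> U \<and> v \<in> V \<and> (int v - int u) mod int c < int d}"
  have fin: "finite U" "finite V" and disj: "U \<inter> V = {}" and sub: "R \<subseteq> U \<times> V"
    by (auto simp: U_def V_def R_def)
  have count: "card {w \<in> {s..<s + int (k * c)}. w mod int c < int d} = k * d" for s k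
    using card_mod_less[of "int c" "int d" s k] assms by simp
  have degU: "card (R `` {u}) = y * d" if "u \<in> U" for u
  proof -
    \<comment> \<open>As \<open>v\<close> runs through \<open>V\<close>, the difference
      \<open>v - u\<close> runs through \<open>M\<close> consecutive integers, the first being
      \<open>N - u\<close>.\<close>
    let ?s = "int N - int u"
    have "bij_betw (\<lambda>v. int v - int u) (R `` {u})
            {w \<in> {?s..<?s + int M}. w mod int c < int d}"
      using that by (intro bij_betw_byWitness[where f' = "\<lambda>w. nat (w + int u)"])
        (auto simp: R_def V_def U_def nat_less_iff le_nat_iff)
    then show ?thesis
      using bij_betw_same_card count[of ?s y] by (fastforce simp: M_def)
  qed
  have degV: "card (R\<inverse> `` {v}) = x * d" if "v \<in> V" for v
  proof -
    \<comment> \<open>Here \<open>u\<close> runs from \<open>0\<close> to \<open>N - 1\<close>, so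
      \<open>v - u\<close> falls from \<open>v\<close> to \<open>v - N + 1\<close>; the least value
      is the start of the window.\<close>
    let ?s = "int v - int N + 1"
    have "bij_betw (\<lambda>u. int v - int u) (R\<inverse> `` {v})
            {w \<in> {?s..<?s + int N}. w mod int c < int d}"
      using that by (intro bij_betw_byWitness[where f' = "\<lambda>w. nat (int v - w)"])
        (auto simp: R_def V_def U_def nat_less_iff le_nat_iff)
    then show ?thesis
      using bij_betw_same_card count[of ?s x] by (fastforce simp: N_def)
  qed
  have "has_order U V (x * c) (y * c)"
    by (simp add: has_order_def U_def V_def N_def M_def)
  then show ?thesis
    using bipartite_graph_of_relation[OF fin disj sub]
      biregular_of_relation[OF disj sub degU degV] by blast
qed

section \<open>The Diophantine equation and its solutions\<close>

lemma admissible_pairs_iff: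
  fixes c d :: int
  assumes "0 < d" "d < c"
  shows "(x, y) \<in> admissible_pairs c d \<longleftrightarrow> d * x - c * (x - y) = 1 \<and> y < x"
proof
  assume "(x, y) \<in> admissible_pairs c d"
  then obtain n m b :: nat where "int n = x * c" "int m = y * c" "int b = x * d" "m < n"
    "int b = int n - int m + 1"
    unfolding admissible_pairs_def by blast
  moreover from this have "y * c < x * c"
    by linarith
  ultimately show "d * x - c * (x - y) = 1 \<and> y < x"
    using assms by (auto simp: algebra_simps)
next
  assume eq: "d * x - c * (x - y) = 1 \<and> y < x"
  then have "0 < c * (x - y)"
    using assms by simp
  then have "0 < d * x"
    using eq by linarith
  then have x: "0 < x"
    using assms by (simp add: zero_less_mult_iff)
  \<comment> \<open>Solving the equation for \<open>c * y\<close> makes positivity of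
    \<open>y\<close> visible, since \<open>d < c\<close> and \<open>0 < x\<close>.\<close>
  have "c * y = (c - d) * x + 1"
    using eq by (simp add: algebra_simps)
  moreover have "0 < (c - d) * x"
    using assms x by simp
  ultimately have "0 < c * y"
    by linarith
  then have y: "0 < y"
    using assms by (simp add: zero_less_mult_iff)
  \<comment> \<open>This is the standing assumption \<open>1 < m\<close>: the bounds on
    \<open>d\<close> force \<open>c\<close> to be at least 2.\<close>
  have "1 * 1 < y * c"
    using assms y by (intro mult_le_less_imp_less) auto
  moreover have "y * c < x * c"
    using assms eq by simp
  moreover have "x * d = x * c - y * c + 1"
    using eq by (simp add: algebra_simps)
  moreover have "\<exists>(U :: nat set) V G. bipartite_graph U V G
      \<and> has_order U V (nat x * nat c) (nat y * nat c)
      \<and> biregular (nat y * nat d) (nat x * nat d) U V G"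
    using assms by (intro biregular_bipartite_graph_exists) auto
  moreover have "int (nat x * nat c) = x * c" "int (nat y * nat c) = y * c"
      "int (nat y * nat d) = y * d" "int (nat x * nat d) = x * d"
    using x y assms by simp_all
  moreover from calculation have "1 < nat y * nat c" "nat y * nat c < nat x * nat c"
      "int (nat x * nat d) = int (nat x * nat c) - int (nat y * nat c) + 1"
    by linarith+
  ultimately show "(x, y) \<in> admissible_pairs c d"
    unfolding admissible_pairs_def using x y by blast
qed

text \<open>The difference of two solutions solves the homogeneous equation, and coprimality makes
  \<open>c\<close> divide \<open>x - x0\<close>.\<close>

lemma bezout_solutions:
  fixes c d x z x0 z0 :: int
  assumes "0 < c" "coprime c d" "d * x0 - c * z0 = 1"
  shows "d * x - c * z = 1 \<longleftrightarrow> (\<exists>l. x = x0 + l * c \<and> z = z0 + l * d)"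
proof
  assume "d * x - c * z = 1"
  then have eq: "d * (x - x0) = c * (z - z0)"
    using assms by (simp add: algebra_simps)
  then have "c dvd x - x0"
    using assms by (metis coprime_dvd_mult_right_iff dvd_triv_left)
  then obtain l where l: "x - x0 = c * l"
    by blast
  then have "c * (d * l) = c * (z - z0)"
    using eq by (simp add: algebra_simps)
  then have "z - z0 = d * l"
    using assms by simp
  with l have "x = x0 + l * c \<and> z = z0 + l * d"
    by (simp add: algebra_simps)
  then show "\<exists>l. x = x0 + l * c \<and> z = z0 + l * d" ..
qed (use assms in \<open>auto simp: algebra_simps\<close>)

text \<open>Only \<open>y < x\<close> restricts the parameter: it says that \<open>z = x - y\<close>
  is positive.\<close>

lemma admissible_pairs_eq_bezout:
  fixes c d x0 z0 :: int
  assumes "0 < d" "d < c" "coprime c d" "d * x0 - c * z0 = 1"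
  shows "admissible_pairs c d = {bezout_pair c d x0 z0 l | l. 0 < z0 + l * d}"
proof -
  have "(x, y) \<in> admissible_pairs c d \<longleftrightarrow>
      (\<exists>l. (x, y) = bezout_pair c d x0 z0 l \<and> 0 < z0 + l * d)" for x y
  proof -
    have "(x, y) \<in> admissible_pairs c d \<longleftrightarrow>
        (\<exists>l. x = x0 + l * c \<and> x - y = z0 + l * d) \<and> 0 < x - y"
      using assms by (simp add: admissible_pairs_iff bezout_solutions[of c d x0 z0])
    also have "\<dots> \<longleftrightarrow> (\<exists>l. x = x0 + l * c \<and> x - y = z0 + l * d \<and> 0 < z0 + l * d)"
      by auto
    also have "\<dots> \<longleftrightarrow> (\<exists>l. (x, y) = bezout_pair c d x0 z0 l \<and> 0 < z0 + l * d)"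
      unfolding bezout_pair_def Let_def by (intro ex_cong1) auto
    finally show ?thesis .
  qed
  then show ?thesis
    by auto
qed

text \<open>Which \<open>l\<close> give admissible pairs depends on the base solution. A suitable
  one makes them exactly the positive \<open>l\<close>; if \<open>z0\<close> is positive,
  \<open>l = 0\<close> is admissible too, so positive \<open>l\<close> alone would miss a pair. For
  an arbitrary base solution, the parameter is therefore restricted by \<open>0 < y\<close> and
  \<open>y < x\<close> instead.\<close>

theorem proposition4p6:
  fixes c d :: int
  assumes "0 < d" and "d < c" and "gcd c d = 1"
  shows "infinite (admissible_pairs c d)
    \<and> (\<forall>(x, y) \<in> admissible_pairs c d. coprime x y)
    \<and> (\<exists>x0 z0. d * x0 + c * (- z0) = 1
         \<and> admissible_pairs c d = {bezout_pair c d x0 z0 l | l. 0 < l})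
    \<and> (\<forall>x0 z0. d * x0 + c * (- z0) = 1 \<longrightarrow>
         admissible_pairs c d =
           {(x, y) | x y l. (x, y) = bezout_pair c d x0 z0 l \<and> 0 < y \<and> y < x}
         \<and> (0 \<le> x0 \<and> 0 \<le> z0 \<longrightarrow>
              (\<forall>l>0. bezout_pair c d x0 z0 l \<in> admissible_pairs c d)))"
proof -
  have cop: "coprime c d"
    using assms by (simp add: coprime_iff_gcd_eq_1)
  note iff = admissible_pairs_iff[OF assms(1,2)]
  note eq_bezout = admissible_pairs_eq_bezout[OF assms(1,2) cop]
  have coprime: "coprime x y" if "(x, y) \<in> admissible_pairs c d" for x y
  proof (rule coprimeI)
    fix k assume "k dvd x" "k dvd y"
    then have "k dvd d * x - c * (x - y)"
      by simp
    then show "is_unit k"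
      using that by (simp add: iff)
  qed
  obtain p q where "p * c + q * d = 1"
    using bezout_int[of c d] assms by auto
  then have pq: "d * q - c * (- p) = 1"
    by (simp add: algebra_simps)
  \<comment> \<open>The solution with the largest \<open>z0 \<le> 0\<close>, so that \<open>z0 + l * d > 0\<close> exactly for \<open>l > 0\<close>.\<close>
  define j where "j = (- p + d - 1) div d"
  define x0 where "x0 = q - j * c"
  define z0 where "z0 = - p - j * d"
  have sol: "d * x0 - c * z0 = 1"
    using pq by (simp add: x0_def z0_def algebra_simps)
  \<comment> \<open>Since \<open>j\<close> is the quotient of \<open>- p\<close> by \<open>d\<close>
    rounded up, \<open>z0\<close> is a remainder modulo \<open>d\<close> shifted down by
    \<open>d - 1\<close>.\<close>
  have "z0 = (- p + d - 1) mod d + 1 - d"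
    by (simp add: z0_def j_def minus_div_mult_eq_mod[symmetric] algebra_simps)
  then have z0: "- d < z0" "z0 \<le> 0"
    using assms pos_mod_bound[of d "- p + d - 1"] pos_mod_sign[of d "- p + d - 1"] by linarith+
  have pos: "0 < z0 + l * d \<longleftrightarrow> 0 < l" for l
  proof
    assume "0 < z0 + l * d"
    then have "0 < l * d" using z0 by linarith
    then show "0 < l" using assms by (simp add: zero_less_mult_iff)
  next
    assume "0 < l"
    then have "1 * d \<le> l * d" using assms by (intro mult_right_mono) auto
    then show "0 < z0 + l * d" using z0 by linarith
  qed
  have param: "admissible_pairs c d = bezout_pair c d x0 z0 ` {0<..}"
    using eq_bezout[OF sol] pos by auto
  \<comment> \<open>Distinct \<open>l\<close> give distinct first components
    \<open>x0 + l * c\<close>, so the infinitely many positive \<open>l\<close> yield infinitely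
    many pairs.\<close>
  have "inj (bezout_pair c d x0 z0)"
    using assms by (auto simp: inj_on_def bezout_pair_def Let_def)
  then have "infinite (admissible_pairs c d)"
    unfolding param using finite_imageD inj_on_subset infinite_Ioi by blast
  moreover have "admissible_pairs c d = {bezout_pair c d x0 z0 l | l. 0 < l}"
    using param by auto
  moreover have "admissible_pairs c d =
        {(x, y) | x y l. (x, y) = bezout_pair c d x1 z1 l \<and> 0 < y \<and> y < x}
      \<and> (0 \<le> x1 \<and> 0 \<le> z1 \<longrightarrow> (\<forall>l>0. bezout_pair c d x1 z1 l \<in> admissible_pairs c d))"
    if "d * x1 + c * (- z1) = 1" for x1 z1
  proof -
    have eq: "admissible_pairs c d = {bezout_pair c d x1 z1 l | l. 0 < z1 + l * d}"
      using that by (intro eq_bezout) simp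
    have "0 < y" if "(x, y) \<in> admissible_pairs c d" for x y
      using that by (simp add: admissible_pairs_def)
    \<comment> \<open>For a pair of the family, \<open>x - y\<close> is \<open>z1 + l * d\<close>,
      so \<open>y < x\<close> is the bound on \<open>l\<close>; \<open>0 < y\<close> holds for every
      admissible pair.\<close>
    then have "admissible_pairs c d =
        {(x, y) | x y l. (x, y) = bezout_pair c d x1 z1 l \<and> 0 < y \<and> y < x}"
      unfolding eq by (fastforce simp: bezout_pair_def Let_def)
    moreover have "bezout_pair c d x1 z1 l \<in> admissible_pairs c d" if "0 \<le> z1" "0 < l" for l
    proof -
      have "0 < z1 + l * d"
        using that assms by (intro add_nonneg_pos mult_pos_pos)
      then show ?thesis
        unfolding eq by blast
    qed
    ultimately show ?thesis
      by blast
  qed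
  ultimately show ?thesis
    using coprime sol by fastforce
qed

end
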